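(* Let $X,Y$ be infinite-dimensional complex Hilbert spaces, let $W\in\mathcal{B}(Y,X)\setminus\{0\}$ and let $A\in\mathcal{B}(X,Y)$ be $W$g-Drazin invertible. The system of conditions $$WAWB=P_{R(WA^{d,W}),\,N(A^{\mathrm{cEP},W}WA)}\quad\text{and}\quad R(B)\subseteq R(A^{d,W})$$ in the unknown $B\in\mathcal{B}(X,Y)$ is consistent and it has the unique solution $B=(A^{\mathrm{cEP},W}W)^2A$.
   Context: $\mathcal{B}(X,Y)$ is the set of bounded linear operators from $X$ to $Y$, $\mathcal{B}(X)=\mathcal{B}(X,X)$; $R(\cdot)$, $N(\cdot)$, $(\cdot)^*$ denote range, null space and adjoint; $P_L$ is the orthogonal projector onto a closed subspace $L$; $P_{L,M}$ is the idempotent with range $L$ and null space $M$. An operator $T\in\mathcal{B}(X)$ is generalized Drazin invertible if there is a (necessarily unique) $T^d\in\mathcal{B}(X)$ with $TT^d=T^dT$, $T^dTT^d=T^d$ and $T-T^2T^d$ quasinilpotent (and similarly on $Y$). For $W\in\mathcal{B}(Y,X)\setminus\{0\}$, an operator $A\in\mathcal{B}(X,Y)$ is $W$g-Drazin invertible if there is a (necessarily unique) $A^{d,W}=B\in\mathcal{B}(X,Y)$ with $AWB=BWA$, $BWAWB=B$ and $A-AWBWA$ quasinilpotent in the weighted sense, i.e. $(A-AWBWA)W$ is a quasinilpotent operator on $Y$. In that case $AW$ and $WA$ are generalized Drazin invertible with $(AW)^d=A^{d,W}W$ and $(WA)^d=WA^{d,W}$. If $A$ is $W$g-Drazin invertible,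 its weighted core-EP inverse $A^{\mathrm{cEP},W}$ is the unique (it exists) operator $B\in\mathcal{B}(X,Y)$ with $WAWB=P_{R((WA)^d)}$ and $R(B)\subseteq R((AW)^d)$. *)

theory Defs
  imports "HOL-Analysis.Analysis"
begin

text \<open>Complex inner product spaces, with the inner product linear in its first argument.
  The norm (inherited from the real normed structure) is the one induced by the inner product,
  and real scalar multiplication is the restriction of complex scalar multiplication.\<close>

class complex_inner = real_normed_vector +
  fixes scaleC :: "complex \<Rightarrow> 'a \<Rightarrow> 'a"  (infixr "*\<^sub>C" 75)
    and cinner :: "'a \<Rightarrow> 'a \<Rightarrow> complex"
  assumes scaleC_add_right: "c *\<^sub>C (x + y) = c *\<^sub>C x + c *\<^sub>C y"
    and scaleC_add_left: "(c + d) *\<^sub>C x = c *\<^sub>C x + d *\<^sub>C x"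
    and scaleC_scaleC: "c *\<^sub>C d *\<^sub>C x = (c * d) *\<^sub>C x"
    and scaleC_one: "1 *\<^sub>C x = x"
    and scaleR_scaleC: "r *\<^sub>R x = complex_of_real r *\<^sub>C x"
    and cinner_add_left: "cinner (x + y) z = cinner x z + cinner y z"
    and cinner_scaleC_left: "cinner (c *\<^sub>C x) y = c * cinner x y"
    and cinner_commute: "cinner x y = cnj (cinner y x)"
    and cinner_self: "cinner x x = complex_of_real ((norm x)\<^sup>2)"

class complex_hilbert = complex_inner + complete_space

lemma vector_space_scaleC:
  "vector_space (scaleC :: complex \<Rightarrow> 'a::complex_inner \<Rightarrow> 'a)"
  by unfold_locales
    (simp_all add: scaleC_add_right scaleC_add_left scaleC_scaleC scaleC_one)

definition infinite_dimensional :: "'a::complex_inner itself \<Rightarrow> bool" where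
  "infinite_dimensional _ \<longleftrightarrow>
     \<not> (\<exists>S :: 'a set. finite S \<and> module.span scaleC S = UNIV)"

definition bounded_clinear :: "('a::complex_inner \<Rightarrow> 'b::complex_inner) \<Rightarrow> bool" where
  "bounded_clinear T \<longleftrightarrow> bounded_linear T \<and> (\<forall>c x. T (c *\<^sub>C x) = c *\<^sub>C T x)"

definition null_space :: "('a::complex_inner \<Rightarrow> 'b::complex_inner) \<Rightarrow> 'a set" where
  "null_space T = {x. T x = 0}"

definition orth_complement :: "'a::complex_inner set \<Rightarrow> 'a set" where
  "orth_complement L = {x. \<forall>y\<in>L. cinner x y = 0}"

text \<open>\<open>is_projector P L M\<close> renders \<open>P = P\<^bsub>L,M\<^esub>\<close>; in particular it includes that the
  bounded idempotent with range \<open>L\<close> and null space \<open>M\<close> exists.\<close>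

definition is_projector ::
    "('a::complex_inner \<Rightarrow> 'a) \<Rightarrow> 'a set \<Rightarrow> 'a set \<Rightarrow> bool" where
  "is_projector P L M \<longleftrightarrow>
     bounded_clinear P \<and> P \<circ> P = P \<and> range P = L \<and> null_space P = M"

definition is_orth_projector :: "('a::complex_inner \<Rightarrow> 'a) \<Rightarrow> 'a set \<Rightarrow> bool" where
  "is_orth_projector P L \<longleftrightarrow> is_projector P L (orth_complement L)"

definition invertible_op :: "('a::complex_inner \<Rightarrow> 'a) \<Rightarrow> bool" where
  "invertible_op T \<longleftrightarrow> (\<exists>S. bounded_clinear S \<and> S \<circ> T = id \<and> T \<circ> S = id)"

definition op_spectrum :: "('a::complex_inner \<Rightarrow> 'a) \<Rightarrow> complex set" where
  "op_spectrum T = {c. \<not> invertible_op (\<lambda>x. c *\<^sub>C x - T x)}"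

definition quasinilpotent :: "('a::complex_inner \<Rightarrow> 'a) \<Rightarrow> bool" where
  "quasinilpotent T \<longleftrightarrow> bounded_clinear T \<and> op_spectrum T = {0}"

definition is_gdrazin_inverse ::
    "('a::complex_inner \<Rightarrow> 'a) \<Rightarrow> ('a \<Rightarrow> 'a) \<Rightarrow> bool" where
  "is_gdrazin_inverse T S \<longleftrightarrow>
     bounded_clinear S \<and> T \<circ> S = S \<circ> T \<and> S \<circ> T \<circ> S = S \<and>
     quasinilpotent (\<lambda>x. T x - (T \<circ> T \<circ> S) x)"

definition gdrazin_inverse :: "('a::complex_inner \<Rightarrow> 'a) \<Rightarrow> 'a \<Rightarrow> 'a" where
  "gdrazin_inverse T = (THE S. is_gdrazin_inverse T S)"

definition is_weighted_gdrazin_inverse ::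
    "('b::complex_inner \<Rightarrow> 'a::complex_inner) \<Rightarrow> ('a \<Rightarrow> 'b) \<Rightarrow> ('a \<Rightarrow> 'b) \<Rightarrow> bool" where
  "is_weighted_gdrazin_inverse W A B \<longleftrightarrow>
     bounded_clinear B \<and> A \<circ> W \<circ> B = B \<circ> W \<circ> A \<and>
     B \<circ> W \<circ> A \<circ> W \<circ> B = B \<and>
     quasinilpotent ((\<lambda>x. A x - (A \<circ> W \<circ> B \<circ> W \<circ> A) x) \<circ> W)"

definition weighted_gdrazin_invertible ::
    "('b::complex_inner \<Rightarrow> 'a::complex_inner) \<Rightarrow> ('a \<Rightarrow> 'b) \<Rightarrow> bool" where
  "weighted_gdrazin_invertible W A \<longleftrightarrow> (\<exists>B. is_weighted_gdrazin_inverse W A B)"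

definition weighted_gdrazin_inverse ::
    "('b::complex_inner \<Rightarrow> 'a::complex_inner) \<Rightarrow> ('a \<Rightarrow> 'b) \<Rightarrow> 'a \<Rightarrow> 'b" where
  "weighted_gdrazin_inverse W A = (THE B. is_weighted_gdrazin_inverse W A B)"

definition is_weighted_core_EP_inverse ::
    "('b::complex_inner \<Rightarrow> 'a::complex_inner) \<Rightarrow> ('a \<Rightarrow> 'b) \<Rightarrow> ('a \<Rightarrow> 'b) \<Rightarrow> bool" where
  "is_weighted_core_EP_inverse W A B \<longleftrightarrow>
     bounded_clinear B \<and>
     is_orth_projector (W \<circ> A \<circ> W \<circ> B) (range (gdrazin_inverse (W \<circ> A))) \<and>
     range B \<subseteq> range (gdrazin_inverse (A \<circ> W))"

definition weighted_core_EP_inverse ::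
    "('b::complex_inner \<Rightarrow> 'a::complex_inner) \<Rightarrow> ('a \<Rightarrow> 'b) \<Rightarrow> 'a \<Rightarrow> 'b" where
  "weighted_core_EP_inverse W A = (THE B. is_weighted_core_EP_inverse W A B)"

end

theory Submission
  imports Defs "HOL-Complex_Analysis.Cauchy_Integral_Formula"
begin

text \<open>
  Write \<open>D\<close> for the weighted g-Drazin inverse and \<open>P\<close> for the orthogonal projector onto \<open>R(WD)\<close>,
  which exists because \<open>R(WD)\<close> is the range of the bounded idempotent \<open>WDWA\<close>. The weighted core-EP
  inverse is \<open>DP\<close>, so the proposed solution is \<open>DPWDPWA = DWDPWA\<close>. As \<open>WAWDWD = WD\<close>, it is sent by
  \<open>WAW\<close> to \<open>WDPWA\<close>, which fixes \<open>R(WD)\<close>; and \<open>W\<close> is injective on \<open>R(D)\<close>, which gives the null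
  space. Uniqueness holds because \<open>DWAW\<close> is the identity on \<open>R(D)\<close>.

  That the g-Drazin inverses are unique, and that \<open>WD\<close> is the g-Drazin inverse of \<open>WA\<close>, needs
  neither the spectral radius formula nor Neumann series: Liouville's theorem applied to resolvents shows
  that \<open>Q Z S = Z\<close> with \<open>Q\<close> quasinilpotent forces \<open>Z = 0\<close>.
\<close>

section \<open>Complex inner products\<close>

lemma scaleC_zero_left [simp]: "0 *\<^sub>C x = (0::'a::complex_inner)"
  using scaleC_add_left[of 0 0 x] by simp

lemma scaleC_minus1: "(-1) *\<^sub>C x = - (x::'a::complex_inner)"
  using scaleR_scaleC[of "-1" x] by simp

lemma scaleC_diff_right: "c *\<^sub>C (x - y) = c *\<^sub>C x - c *\<^sub>C (y::'a::complex_inner)"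
  using scaleC_add_right[of c "x - y" y] by (simp add: algebra_simps)

lemma scaleC_diff_left: "(c - d) *\<^sub>C x = c *\<^sub>C x - d *\<^sub>C (x::'a::complex_inner)"
  using scaleC_add_left[of "c - d" d x] by (simp add: algebra_simps)

lemma cinner_add_right: "cinner x (y + z) = cinner x y + cinner x z"
  by (metis cinner_add_left cinner_commute complex_cnj_add)

lemma cinner_scaleC_right: "cinner x (c *\<^sub>C y) = cnj c * cinner x y"
  by (metis cinner_scaleC_left cinner_commute complex_cnj_mult)

lemma cinner_zero_left [simp]: "cinner 0 y = 0"
  using cinner_scaleC_left[of 0 0 y] by simp

lemma cinner_diff_left: "cinner (x - y) z = cinner x z - cinner y z"
  using cinner_add_left[of "x - y" y z] by simp

lemma norm_add_square:
  "(norm (x + y))\<^sup>2 = (norm x)\<^sup>2 + (norm y)\<^sup>2 + 2 * Re (cinner x (y::'a::complex_inner))"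
proof -
  have "complex_of_real ((norm (x + y))\<^sup>2)
      = of_real ((norm x)\<^sup>2) + of_real ((norm y)\<^sup>2) + (cinner x y + cnj (cinner x y))"
    using cinner_commute[of y x]
    by (simp add: cinner_self[symmetric] cinner_add_left cinner_add_right del: of_real_power)
  also have "\<dots> = of_real ((norm x)\<^sup>2 + (norm y)\<^sup>2 + 2 * Re (cinner x y))"
    by (simp add: complex_add_cnj)
  finally show ?thesis using of_real_eq_iff by blast
qed

text \<open>The class grants homogeneity of the norm for real scalars only; the complex case is read
  off from the inner product.\<close>

lemma norm_scaleC: "norm (c *\<^sub>C (x::'a::complex_inner)) = cmod c * norm x"
proof -
  have "complex_of_real ((norm (c *\<^sub>C x))\<^sup>2) = c * cnj c * of_real ((norm x)\<^sup>2)"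
    by (simp add: cinner_self[symmetric] cinner_scaleC_left cinner_scaleC_right del: of_real_power)
  also have "\<dots> = of_real ((cmod c * norm x)\<^sup>2)"
    by (simp add: complex_norm_square[symmetric] power_mult_distrib)
  finally have "(norm (c *\<^sub>C x))\<^sup>2 = (cmod c * norm x)\<^sup>2" using of_real_eq_iff by blast
  then show ?thesis by (simp add: power2_eq_iff_nonneg)
qed

lemma parallelogram_law:
  "(norm (x + y))\<^sup>2 + (norm (x - y))\<^sup>2 = 2 * (norm x)\<^sup>2 + 2 * (norm (y::'a::complex_inner))\<^sup>2"
proof -
  have "cinner x (- y) = - cinner x y"
    using cinner_scaleC_right[of x "-1" y] by (simp add: scaleC_minus1)
  then show ?thesis using norm_add_square[of x y] norm_add_square[of x "- y"] by simp
qed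

text \<open>Pythagoras for the residual of \<open>x\<close> after removing its component along
  \<open>y\<close>. Nonnegativity of the left side gives Cauchy-Schwarz; the strict decrease when
  \<open>cinner x y\<close> is nonzero makes closest points orthogonal.\<close>

lemma norm_diff_component_square:
  assumes "y \<noteq> (0::'a::complex_inner)"
  shows "(norm (x - (cinner x y / of_real ((norm y)\<^sup>2)) *\<^sub>C y))\<^sup>2
    = (norm x)\<^sup>2 - (cmod (cinner x y))\<^sup>2 / (norm y)\<^sup>2"
proof -
  let ?c = "cinner x y" and ?t = "- (cinner x y / of_real ((norm y)\<^sup>2))"
  have "?t *\<^sub>C y = - ((?c / of_real ((norm y)\<^sup>2)) *\<^sub>C y)"
    using scaleC_scaleC[of "-1" "?c / of_real ((norm y)\<^sup>2)" y] by (simp add: scaleC_minus1)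
  moreover have "(norm (?t *\<^sub>C y))\<^sup>2 = (cmod ?c)\<^sup>2 / (norm y)\<^sup>2"
    using assms by (simp add: norm_scaleC norm_divide norm_power)
      (simp add: power2_eq_square)
  moreover have "Re (cinner x (?t *\<^sub>C y)) = - ((cmod ?c)\<^sup>2 / (norm y)\<^sup>2)"
  proof -
    have "cinner x (?t *\<^sub>C y) = - (?c * cnj ?c) / of_real ((norm y)\<^sup>2)"
      by (simp add: cinner_scaleC_right)
    also have "\<dots> = of_real (- ((cmod ?c)\<^sup>2 / (norm y)\<^sup>2))"
      by (simp add: complex_norm_square[symmetric])
    finally show ?thesis by (metis Re_complex_of_real)
  qed
  ultimately show ?thesis
    using norm_add_square[of x "?t *\<^sub>C y"] by (simp add: algebra_simps)
qed

lemma complex_Cauchy_Schwarz: "cmod (cinner x y) \<le> norm x * norm (y::'a::complex_inner)"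
proof (cases "y = 0")
  case True
  then show ?thesis using cinner_commute[of x 0] by simp
next
  case False
  have "(cmod (cinner x y))\<^sup>2 / (norm y)\<^sup>2 \<le> (norm x)\<^sup>2"
    using norm_diff_component_square[OF False, of x]
    by (metis diff_ge_0_iff_ge zero_le_power2)
  then have "(cmod (cinner x y))\<^sup>2 \<le> (norm x * norm y)\<^sup>2"
    using False by (simp add: divide_simps power_mult_distrib)
  then show ?thesis by (rule power2_le_imp_le) simp
qed

section \<open>Bounded complex linear operators\<close>

lemma bounded_clinear_bounded_linear: "bounded_clinear T \<Longrightarrow> bounded_linear T"
  by (simp add: bounded_clinear_def)

lemma bounded_clinear_add: "bounded_clinear T \<Longrightarrow> T (x + y) = T x + T y"
  by (simp add: bounded_clinear_def bounded_linear.linear linear_add)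

lemma bounded_clinear_diff: "bounded_clinear T \<Longrightarrow> T (x - y) = T x - T y"
  by (simp add: bounded_clinear_def bounded_linear.linear linear_diff)

lemma bounded_clinear_zero: "bounded_clinear T \<Longrightarrow> T 0 = 0"
  by (simp add: bounded_clinear_def bounded_linear.linear linear_0)

lemma bounded_clinear_scaleC: "bounded_clinear T \<Longrightarrow> T (c *\<^sub>C x) = c *\<^sub>C T x"
  by (simp add: bounded_clinear_def)

lemmas bounded_clinear_simps =
  bounded_clinear_add bounded_clinear_diff bounded_clinear_zero bounded_clinear_scaleC

lemma bounded_clinear_ident: "bounded_clinear (\<lambda>x. x)"
  by (simp add: bounded_clinear_def bounded_linear_ident)

lemma bounded_clinear_compose:
  "bounded_clinear S \<Longrightarrow> bounded_clinear T \<Longrightarrow> bounded_clinear (\<lambda>x. S (T x))"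
  by (simp add: bounded_clinear_def bounded_linear_compose)

lemma bounded_clinear_comp:
  "bounded_clinear S \<Longrightarrow> bounded_clinear T \<Longrightarrow> bounded_clinear (S \<circ> T)"
  by (simp add: bounded_clinear_compose o_def)

lemma bounded_clinear_plus:
  "bounded_clinear S \<Longrightarrow> bounded_clinear T \<Longrightarrow> bounded_clinear (\<lambda>x. S x + T x)"
  by (simp add: bounded_clinear_def bounded_linear_add scaleC_add_right)

lemma bounded_clinear_minus:
  "bounded_clinear S \<Longrightarrow> bounded_clinear T \<Longrightarrow> bounded_clinear (\<lambda>x. S x - T x)"
  by (simp add: bounded_clinear_def bounded_linear_sub scaleC_diff_right)

lemma bounded_clinear_scale:
  assumes "bounded_clinear T"
  shows "bounded_clinear (\<lambda>x. c *\<^sub>C T x)"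
proof -
  have "bounded_linear (\<lambda>x. c *\<^sub>C x :: 'b)"
    by (rule bounded_linear_intro[where K = "cmod c"])
      (simp_all add: scaleC_add_right scaleR_scaleC scaleC_scaleC mult.commute norm_scaleC)
  then show ?thesis
    using assms bounded_linear_compose[of "\<lambda>x. c *\<^sub>C x" T]
    by (simp add: bounded_clinear_def scaleC_scaleC mult.commute)
qed

lemmas bounded_clinear_intros = bounded_clinear_ident bounded_clinear_plus
  bounded_clinear_minus bounded_clinear_scale

text \<open>The vector \<open>x - P x\<close> lies in the common null space, so
  \<open>P' x = P' (P x)\<close>, and \<open>P'\<close> fixes the common range.\<close>

lemma is_projector_unique:
  assumes "is_projector P L M" and "is_projector P' L M"
  shows "P = P'"
proof
  fix x
  have P: "bounded_clinear P" "\<And>x. P (P x) = P x" "range P = L" "null_space P = M"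
    and P': "bounded_clinear P'" "\<And>x. P' (P' x) = P' x" "range P' = L" "null_space P' = M"
    using assms by (auto simp: is_projector_def fun_eq_iff)
  have "P (x - P x) = 0" by (simp add: bounded_clinear_simps P)
  then have "P' (x - P x) = 0" using P(4) P'(4) by (auto simp: null_space_def)
  moreover obtain z where "P x = P' z" using P(3) P'(3) by blast
  ultimately show "P x = P' x" using P'(1,2) by (simp add: bounded_clinear_simps)
qed

section \<open>Orthogonal projection\<close>

text \<open>A minimizing sequence is Cauchy by the parallelogram law, for which closure under
  midpoints is enough; completeness supplies the limit.\<close>

lemma closest_point_exists_complete:
  fixes L :: "'a::complex_hilbert set"
  assumes "closed L" and "L \<noteq> {}" and midpoint: "\<And>y z. y \<in> L \<Longrightarrow> z \<in> L \<Longrightarrow> (1/2) *\<^sub>R (y + z) \<in> L"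
  obtains p where "p \<in> L" "\<And>y. y \<in> L \<Longrightarrow> norm (x - p) \<le> norm (x - y)"
proof -
  define d where "d = infdist x L"
  have d_le: "d \<le> norm (x - y)" if "y \<in> L" for y
    using infdist_le[OF that, of x] by (simp add: d_def dist_norm)
  have d0: "d \<ge> 0" by (simp add: d_def infdist_nonneg)
  \<comment> \<open>The slack is put on the squared distance, the quantity that the parallelogram
    law handles.\<close>
  have "\<exists>y\<in>L. (norm (x - y))\<^sup>2 < d\<^sup>2 + inverse (real (Suc n))" for n
  proof (rule ccontr)
    assume "\<not> ?thesis"
    then have *: "d\<^sup>2 + inverse (real (Suc n)) \<le> (norm (x - y))\<^sup>2" if "y \<in> L" for y
      using that by force
    have "sqrt (d\<^sup>2 + inverse (real (Suc n))) \<le> dist x y" if "y \<in> L" for y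
      unfolding dist_norm by (rule real_le_lsqrt) (use *[OF that] in auto)
    then have "sqrt (d\<^sup>2 + inverse (real (Suc n))) \<le> infdist x L"
      unfolding infdist_notempty[OF \<open>L \<noteq> {}\<close>] by (intro cINF_greatest \<open>L \<noteq> {}\<close>)
    then have "d\<^sup>2 + inverse (real (Suc n)) \<le> d\<^sup>2"
      using d0 real_sqrt_le_iff[of "d\<^sup>2 + inverse (real (Suc n))" "d\<^sup>2"] by (simp add: d_def)
    then show False by simp
  qed
  then obtain y where y: "\<And>n. y n \<in> L"
      "\<And>n. (norm (x - y n))\<^sup>2 < d\<^sup>2 + inverse (real (Suc n))"
    by metis
  \<comment> \<open>The midpoint of \<open>y m\<close> and \<open>y n\<close> is in
    \<open>L\<close>, so the sum term of the parallelogram law is at least \<open>4 * d^2\<close>;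
    this cancels the main terms and leaves only the slacks.\<close>
  have close: "(norm (y m - y n))\<^sup>2 \<le> 2 * inverse (real (Suc m)) + 2 * inverse (real (Suc n))" for m n
  proof -
    have "(x - y m) + (x - y n) = 2 *\<^sub>R (x - (1/2) *\<^sub>R (y m + y n))"
      by (simp add: algebra_simps scaleR_2)
    then have "norm ((x - y m) + (x - y n)) = 2 * norm (x - (1/2) *\<^sub>R (y m + y n))"
      by simp
    then have "(norm ((x - y m) + (x - y n)))\<^sup>2 \<ge> 4 * d\<^sup>2"
      using power_mono[OF d_le[OF midpoint[OF y(1)[of m] y(1)[of n]]] d0, of 2]
      by (simp add: power_mult_distrib)
    moreover have "(x - y m) - (x - y n) = - (y m - y n)" by simp
    ultimately show ?thesis
      using parallelogram_law[of "x - y m" "x - y n"] y(2)[of m] y(2)[of n]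
      by (simp only: norm_minus_cancel)
  qed
  have "Cauchy y"
  proof (rule CauchyI)
    fix e :: real assume e: "e > 0"
    then obtain N where N: "inverse (real (Suc N)) < e\<^sup>2 / 4"
      using reals_Archimedean[of "e\<^sup>2 / 4"] by auto
    have "norm (y m - y n) < e" if "m \<ge> N" "n \<ge> N" for m n
    proof -
      have "inverse (real (Suc m)) \<le> inverse (real (Suc N))" "inverse (real (Suc n)) \<le> inverse (real (Suc N))"
        using that by (auto intro!: le_imp_inverse_le)
      then have "(norm (y m - y n))\<^sup>2 < e\<^sup>2" using close[of m n] N by linarith
      then show ?thesis by (rule power2_less_imp_less) (use e in simp)
    qed
    then show "\<exists>M. \<forall>m\<ge>M. \<forall>n\<ge>M. norm (y m - y n) < e" by blast
  qed
  then obtain p where p: "y \<longlonglongrightarrow> p" using convergent_eq_Cauchy by blast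
  have "p \<in> L" using closed_sequentially[OF \<open>closed L\<close> y(1) p] .
  moreover have "norm (x - p) \<le> d"
  proof -
    have "(\<lambda>n. (norm (x - y n))\<^sup>2) \<longlonglongrightarrow> (norm (x - p))\<^sup>2" by (intro tendsto_intros p)
    moreover have "(\<lambda>n. d\<^sup>2 + inverse (real (Suc n))) \<longlonglongrightarrow> d\<^sup>2 + 0"
      by (intro tendsto_intros LIMSEQ_inverse_real_of_nat)
    ultimately have "(norm (x - p))\<^sup>2 \<le> d\<^sup>2 + 0"
      by (rule LIMSEQ_le) (use y(2) less_imp_le in blast)
    then show ?thesis using power2_le_imp_le[OF _ d0] by simp
  qed
  ultimately show thesis using that d_le by (meson order_trans)
qed

text \<open>The projector sends a point to its closest point in \<open>L\<close>; Pythagoras bounds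
  its norm by 1.\<close>

lemma is_orth_projector_exists:
  fixes L :: "'a::complex_hilbert set"
  assumes "closed L" and "0 \<in> L" and add: "\<And>y z. y \<in> L \<Longrightarrow> z \<in> L \<Longrightarrow> y + z \<in> L"
    and scale: "\<And>c y. y \<in> L \<Longrightarrow> c *\<^sub>C y \<in> L"
  obtains P where "is_orth_projector P L"
proof -
  have diff: "y - z \<in> L" if "y \<in> L" "z \<in> L" for y z
    using add[OF that(1) scale[OF that(2), of "-1"]] by (simp add: scaleC_minus1)
  have orth0: "u = 0" if "u \<in> L" "u \<in> orth_complement L" for u
    using that cinner_self[of u] by (auto simp: orth_complement_def)
  have orth_add: "u + v \<in> orth_complement L" if "u \<in> orth_complement L" "v \<in> orth_complement L" for u v
    using that by (simp add: orth_complement_def cinner_add_left)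
  have orth_diff: "u - v \<in> orth_complement L" if "u \<in> orth_complement L" "v \<in> orth_complement L" for u v
    using that by (simp add: orth_complement_def cinner_diff_left)
  have orth_scale: "c *\<^sub>C u \<in> orth_complement L" if "u \<in> orth_complement L" for c u
    using that by (simp add: orth_complement_def cinner_scaleC_left)
  have "\<exists>p\<in>L. x - p \<in> orth_complement L" for x
  proof -
    obtain p where p: "p \<in> L" "\<And>y. y \<in> L \<Longrightarrow> norm (x - p) \<le> norm (x - y)"
    proof (rule closest_point_exists_complete[of L x])
      show "(1/2) *\<^sub>R (y + z) \<in> L" if "y \<in> L" "z \<in> L" for y z
        using that by (simp only: scaleR_scaleC add scale)
    qed (use assms in auto)
    have "cinner (x - p) y = 0" if y: "y \<in> L" for y
    proof (cases "y = 0")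
      case True
      then show ?thesis using cinner_commute[of _ 0] by simp
    next
      case False
      \<comment> \<open>Moving from \<open>p\<close> by \<open>?t *\<^sub>C y\<close> stays in
        \<open>L\<close> and would come strictly closer to \<open>x\<close> unless the inner product
        vanishes.\<close>
      let ?t = "cinner (x - p) y / of_real ((norm y)\<^sup>2)"
      have "norm (x - p) \<le> norm (x - p - ?t *\<^sub>C y)"
        using p(2)[OF add[OF p(1) scale[OF y, of ?t]]] by (simp add: diff_diff_eq)
      then have "(norm (x - p))\<^sup>2 \<le> (norm (x - p - ?t *\<^sub>C y))\<^sup>2"
        by (rule power_mono) simp
      then have "(cmod (cinner (x - p) y))\<^sup>2 / (norm y)\<^sup>2 \<le> 0"
        using norm_diff_component_square[OF False, of "x - p"] by linarith
      then show ?thesis using False by (simp add: divide_le_0_iff)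
    qed
    then show ?thesis using p(1) by (auto simp: orth_complement_def)
  qed
  then obtain P where P: "\<And>x. P x \<in> L" "\<And>x. x - P x \<in> orth_complement L" by metis
  \<comment> \<open>Since \<open>L\<close> meets its complement only in 0, the decomposition is
    unique. Linearity of \<open>P\<close> and its values on \<open>L\<close> then follow by
    exhibiting a decomposition.\<close>
  have eq: "P x = p" if "p \<in> L" "x - p \<in> orth_complement L" for x p
    using orth0[OF diff[OF that(1) P(1)[of x]]] orth_diff[OF P(2)[of x] that(2)] by simp
  have P_scaleC: "P (c *\<^sub>C x) = c *\<^sub>C P x" for c x
    by (rule eq) (use scale P orth_scale in \<open>auto simp flip: scaleC_diff_right\<close>)
  have P_add: "P (x + y) = P x + P y" for x y
    by (rule eq) (use add P orth_add[OF P(2)[of x] P(2)[of y]] in \<open>auto simp: algebra_simps\<close>)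
  have norm_P: "norm (P x) \<le> norm x" for x
  proof -
    have "cinner (x - P x) (P x) = 0" using P by (auto simp: orth_complement_def)
    then have "(norm x)\<^sup>2 = (norm (x - P x))\<^sup>2 + (norm (P x))\<^sup>2"
      using norm_add_square[of "x - P x" "P x"] by simp
    then show ?thesis using power2_le_imp_le[of "norm (P x)" "norm x"] by simp
  qed
  have "bounded_linear P"
    by (rule bounded_linear_intro[where K = 1])
      (simp_all add: P_add P_scaleC scaleR_scaleC norm_P)
  then have "bounded_clinear P" by (simp add: bounded_clinear_def P_scaleC)
  moreover have fix_L: "P x = x" if "x \<in> L" for x
    by (rule eq) (use that in \<open>auto simp: orth_complement_def\<close>)
  moreover have "range P = L" using P(1) fix_L by (metis image_subset_iff rangeI subsetI subset_antisym)
  moreover have "null_space P = orth_complement L"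
  proof -
    have "P x = 0 \<longleftrightarrow> x \<in> orth_complement L" for x
      using P(2)[of x] eq[OF \<open>0 \<in> L\<close>, of x] by auto
    then show ?thesis by (auto simp: null_space_def)
  qed
  moreover have "P \<circ> P = P" using fix_L[OF P(1)] by (simp add: fun_eq_iff)
  ultimately have "is_orth_projector P L"
    unfolding is_orth_projector_def is_projector_def by blast
  then show thesis by (rule that)
qed

text \<open>The range of an idempotent is its set of fixed points, hence closed by
  continuity.\<close>

lemma is_orth_projector_range_idempotent:
  fixes E :: "'a::complex_hilbert \<Rightarrow> 'a"
  assumes "bounded_clinear E" and "\<And>x. E (E x) = E x"
  obtains P where "is_orth_projector P (range E)"
proof (rule is_orth_projector_exists[of "range E"])
  have "range E = {x. E x - x = 0}" using assms(2) by (auto intro: range_eqI[of _ E, OF sym])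
  moreover have "closed {x. E x - x = 0}"
    by (intro closed_Collect_eq continuous_intros linear_continuous_on
        bounded_clinear_bounded_linear assms(1))
  ultimately show "closed (range E)" by simp
  show "0 \<in> range E" using assms(1) by (metis bounded_clinear_zero rangeI)
  show "y + z \<in> range E" if "y \<in> range E" "z \<in> range E" for y z
    using that assms(1) by (auto simp flip: bounded_clinear_add)
  show "c *\<^sub>C y \<in> range E" if "y \<in> range E" for c y
    using that assms(1) by (auto simp flip: bounded_clinear_scaleC)
qed (rule that)

section \<open>Operators without nonzero spectrum\<close>

text \<open>The family \<open>R l\<close> is the inverse of \<open>1 - l Q\<close>, not of
  \<open>l - Q\<close>, so that it can be defined on the whole plane when \<open>Q\<close> has no
  nonzero spectrum. The resolvent identity together with pointwise continuity gives the
  derivative.\<close>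

lemma resolvent_holomorphic:
  fixes R :: "complex \<Rightarrow> 'a::complex_inner \<Rightarrow> 'a" and \<phi> :: "'a \<Rightarrow> complex"
  assumes Q: "bounded_clinear Q" and R: "\<And>l. bounded_clinear (R l)"
    and RL: "\<And>l x. R l (x - l *\<^sub>C Q x) = x" and RR: "\<And>l x. R l x - l *\<^sub>C Q (R l x) = x"
    and \<phi>: "bounded_linear \<phi>" "\<And>c x. \<phi> (c *\<^sub>C x) = c * \<phi> x"
  shows "(\<lambda>l. \<phi> (R l x)) holomorphic_on UNIV"
proof -
  have resolvent: "R l z - R m z = (l - m) *\<^sub>C R l (Q (R m z))" for l m z
  proof -
    have "R l z - R m z = R l (R m z - m *\<^sub>C Q (R m z)) - R l (R m z - l *\<^sub>C Q (R m z))"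
      by (simp only: RL RR)
    also have "\<dots> = (l - m) *\<^sub>C R l (Q (R m z))"
      by (simp add: bounded_clinear_simps[OF R] scaleC_diff_left)
    finally show ?thesis .
  qed
  have cont: "((\<lambda>l. R l z) \<longlongrightarrow> R m z) (at m)" for m z
  proof -
    have "bounded_linear (\<lambda>x. R m (Q x))"
      by (intro bounded_clinear_bounded_linear bounded_clinear_compose[OF R Q])
    from bounded_linear.pos_bounded[OF this]
    obtain K where K: "K > 0" "\<And>x. norm (R m (Q x)) \<le> norm x * K" by auto
    \<comment> \<open>The resolvent identity is used with \<open>l\<close> and \<open>m\<close>
      exchanged, so that the outer operator is the fixed \<open>R m\<close>, whose bound
      \<open>K\<close> does not depend on \<open>l\<close>.\<close>
    have step: "norm (R l z - R m z) \<le> cmod (l - m) * K * norm (R l z)" for l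
    proof -
      have "norm (R l z - R m z) = norm (R m z - R l z)" by (rule norm_minus_commute)
      also have "\<dots> = cmod (l - m) * norm (R m (Q (R l z)))"
        by (simp only: resolvent norm_scaleC norm_minus_commute)
      also have "\<dots> \<le> cmod (l - m) * (norm (R l z) * K)" by (intro mult_left_mono K) simp
      finally show ?thesis by (simp add: mult_ac)
    qed
    \<comment> \<open>This radius makes the factor \<open>cmod (l - m) * K\<close> at most 1/2, so
      that \<open>norm (R l z)\<close> can be absorbed and is at most
      \<open>2 * norm (R m z)\<close>.\<close>
    have "eventually (\<lambda>l. dist l m < 1 / (2 * K)) (at m)"
      using K(1) by (auto simp: eventually_at intro!: exI[of _ "1 / (2 * K)"])
    then have "eventually (\<lambda>l. norm (R l z - R m z) \<le> cmod (l - m) * (2 * K * norm (R m z))) (at m)"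
    proof eventually_elim
      case (elim l)
      then have "cmod (l - m) * K \<le> 1 / 2" using K(1) by (simp add: dist_norm field_simps)
      then have "cmod (l - m) * K * norm (R l z) \<le> 1 / 2 * norm (R l z)"
        by (rule mult_right_mono) simp
      then have "norm (R l z - R m z) \<le> 1 / 2 * norm (R l z)" using step[of l] by linarith
      then have "norm (R l z) \<le> 2 * norm (R m z)" using norm_triangle_ineq2[of "R l z" "R m z"] by linarith
      then have "cmod (l - m) * K * norm (R l z) \<le> cmod (l - m) * K * (2 * norm (R m z))"
        using K(1) by (intro mult_left_mono) auto
      then show ?case using step[of l] by (simp add: mult_ac)
    qed
    moreover have "((\<lambda>l. cmod (l - m) * (2 * K * norm (R m z))) \<longlongrightarrow> 0) (at m)"
      by (auto intro!: tendsto_eq_intros)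
    ultimately have "((\<lambda>l. R l z - R m z) \<longlongrightarrow> 0) (at m)"
      by (rule Lim_null_comparison)
    then show ?thesis by (simp add: LIM_zero_iff)
  qed
  have "((\<lambda>l. \<phi> (R l x)) has_field_derivative \<phi> (R m (Q (R m x)))) (at m)" for m
  proof -
    have "((\<lambda>l. \<phi> (R l (Q (R m x)))) \<longlongrightarrow> \<phi> (R m (Q (R m x)))) (at m)"
      by (intro bounded_linear.tendsto[OF \<phi>(1)] cont)
    moreover have "\<forall>\<^sub>F l in at m. \<phi> (R l (Q (R m x))) = (\<phi> (R l x) - \<phi> (R m x)) / (l - m)"
      unfolding eventually_at_filter
    proof (intro always_eventually allI impI)
      fix l assume "l \<noteq> m"
      have "\<phi> (R l x) - \<phi> (R m x) = (l - m) * \<phi> (R l (Q (R m x)))"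
        by (simp add: linear_diff[symmetric] bounded_linear.linear \<phi> resolvent)
      then show "\<phi> (R l (Q (R m x))) = (\<phi> (R l x) - \<phi> (R m x)) / (l - m)"
        using \<open>l \<noteq> m\<close> by simp
    qed
    ultimately show ?thesis
      unfolding has_field_derivative_iff by (rule Lim_transform_eventually)
  qed
  then show ?thesis by (auto simp: holomorphic_on_open)
qed

text \<open>For nonzero \<open>l\<close>, \<open>1 - l Q\<close> is \<open>l\<close> times
  \<open>1/l - Q\<close>, and \<open>1/l\<close> is outside the spectrum; for \<open>l = 0\<close>
  it is the identity.\<close>

lemma quasinilpotent_resolvent:
  assumes Q: "op_spectrum Q \<subseteq> {0}"
  obtains R where "\<And>l. bounded_clinear (R l)"
    "\<And>l x. R l (x - l *\<^sub>C Q x) = x" "\<And>l x. R l x - l *\<^sub>C Q (R l x) = x"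
proof -
  have "\<exists>V. bounded_clinear V \<and> (\<forall>x. V (x - l *\<^sub>C Q x) = x) \<and> (\<forall>x. V x - l *\<^sub>C Q (V x) = x)" for l
  proof (cases "l = 0")
    case True
    then show ?thesis using bounded_clinear_ident by (intro exI[of _ "\<lambda>x. x"]) simp
  next
    case False
    then have "1 / l \<notin> op_spectrum Q" using Q by auto
    then obtain V where V: "bounded_clinear V" "\<And>x. V ((1 / l) *\<^sub>C x - Q x) = x"
        "\<And>x. (1 / l) *\<^sub>C V x - Q (V x) = x"
      unfolding op_spectrum_def invertible_op_def by (auto simp: fun_eq_iff)
    have split: "x - l *\<^sub>C Q x = l *\<^sub>C ((1 / l) *\<^sub>C x - Q x)" for x
      using False by (simp add: scaleC_diff_right scaleC_scaleC scaleC_one)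
    have "bounded_clinear (\<lambda>x. V ((1 / l) *\<^sub>C x))"
      by (intro bounded_clinear_intros bounded_clinear_compose[OF V(1)])
    then show ?thesis
      using False V(2,3) by (intro exI[of _ "\<lambda>x. V ((1 / l) *\<^sub>C x)"])
        (simp add: split scaleC_scaleC scaleC_one)
  qed
  then show thesis using that by metis
qed

text \<open>For \<open>cmod l > M\<close> the bound gives
  \<open>onorm (G l) \<le> K / (cmod l - M)\<close>, so each coefficient is an entire function that
  tends to 0 at infinity.\<close>

lemma operator_family_vanishes:
  fixes G :: "complex \<Rightarrow> 'a::complex_inner \<Rightarrow> 'b::complex_inner"
  assumes G: "\<And>l. bounded_clinear (G l)"
    and hol: "\<And>x y. (\<lambda>l. cinner (G l x) y) holomorphic_on UNIV"
    and bound: "\<And>l. cmod l * onorm (G l) \<le> K + M * onorm (G l)"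
  shows "G l x = 0"
proof -
  have lim: "((\<lambda>l. cinner (G l x) y) \<longlongrightarrow> 0) at_infinity" for y
  proof (rule Lim_null_comparison)
    have "eventually (\<lambda>l. cmod l > M) at_infinity"
      unfolding eventually_at_infinity by (intro exI[of _ "M + 1"]) auto
    then show "\<forall>\<^sub>F l in at_infinity. norm (cinner (G l x) y) \<le> K / (- M + norm l) * norm x * norm y"
    proof eventually_elim
      case (elim l)
      then have "onorm (G l) \<le> K / (- M + norm l)" using bound[of l] by (simp add: field_simps)
      then have "norm (G l x) \<le> K / (- M + norm l) * norm x"
        using onorm[OF bounded_clinear_bounded_linear[OF G], of l x]
        by (meson mult_right_mono norm_ge_zero order_trans)
      then show ?case
        using complex_Cauchy_Schwarz[of "G l x" y] by (meson mult_right_mono norm_ge_zero order_trans)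
    qed
    have "filterlim (\<lambda>l::complex. - M + norm l) at_infinity at_infinity"
      by (intro filterlim_at_top_imp_at_infinity filterlim_tendsto_add_at_top[OF tendsto_const]
          filterlim_norm_at_top)
    then have "((\<lambda>l::complex. K / (- M + norm l)) \<longlongrightarrow> 0) at_infinity"
      by (rule tendsto_divide_0[OF tendsto_const])
    then show "((\<lambda>l::complex. K / (- M + norm l) * norm x * norm y) \<longlongrightarrow> 0) at_infinity"
      by (intro tendsto_mult_left_zero)
  qed
  \<comment> \<open>Here \<open>y\<close> is the constant vector \<open>G l x\<close> for the given
    \<open>l\<close>; the entire function is evaluated at that same \<open>l\<close>.\<close>
  have "cinner (G l x) (G l x) = 0" by (rule Liouville_weak_0[OF hol lim])
  then show ?thesis by (simp add: cinner_self)
qed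

text \<open>These are the functionals \<phi> to which \<open>resolvent_holomorphic\<close> is
  applied, with \<open>T\<close> the identity or \<open>Z\<close>.\<close>

lemma cinner_functional:
  assumes "bounded_clinear T"
  shows "bounded_linear (\<lambda>x. cinner (T x) y)" and "cinner (T (c *\<^sub>C x)) y = c * cinner (T x) y"
proof -
  have "bounded_linear (\<lambda>x. cinner x y)"
    by (rule bounded_linear_intro[where K = "norm y"])
      (simp_all add: cinner_add_left scaleR_scaleC cinner_scaleC_left complex_Cauchy_Schwarz
        scaleR_conv_of_real)
  then show "bounded_linear (\<lambda>x. cinner (T x) y)"
    using bounded_linear_compose bounded_clinear_bounded_linear[OF assms] by blast
  show "cinner (T (c *\<^sub>C x)) y = c * cinner (T x) y"
    by (simp add: assms bounded_clinear_scaleC cinner_scaleC_left)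
qed

text \<open>Since \<open>(1 - l Q)\<inverse> Z\<close> multiplied by \<open>S - l\<close> is the constant \<open>Z S\<close>, this entire
  family tends to \<open>0\<close> at infinity, and Liouville's theorem applies.\<close>

lemma quasinilpotent_left_zero:
  assumes Q: "bounded_clinear Q" "op_spectrum Q \<subseteq> {0}"
    and Z: "bounded_clinear Z" and S: "bounded_clinear S" and QZS: "\<And>x. Q (Z (S x)) = Z x"
  shows "Z x = 0"
proof -
  obtain R where R: "\<And>l. bounded_clinear (R l)" "\<And>l x. R l (x - l *\<^sub>C Q x) = x"
      "\<And>l x. R l x - l *\<^sub>C Q (R l x) = x"
    using quasinilpotent_resolvent[OF Q(2)] by metis
  \<comment> \<open>At parameter 0 the resolvent is the identity, so this value is
    \<open>Z x\<close>.\<close>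
  have "R 0 (Z x) = 0"
  proof (rule operator_family_vanishes[of "\<lambda>l x. R l (Z x)"])
    show G: "bounded_clinear (\<lambda>x. R l (Z x))" for l by (intro bounded_clinear_intros bounded_clinear_compose[OF R(1)]
        bounded_clinear_compose[OF Z])
    show "(\<lambda>l. cinner (R l (Z x)) y) holomorphic_on UNIV" for x y
      by (rule resolvent_holomorphic[OF Q(1) R(1,2,3)])
        (use cinner_functional[OF bounded_clinear_ident] in auto)
    fix l
    have "l *\<^sub>C R l (Z x) = R l (Z (S x)) - Z (S x)" for x
      using R(2)[of l "Z (S x)"] by (simp add: QZS bounded_clinear_simps R(1) algebra_simps)
    then have "(\<lambda>x. l *\<^sub>C R l (Z x)) = (\<lambda>x. R l (Z (S x)) + - Z (S x))" by auto
    moreover have "onorm (\<lambda>x. R l (Z (S x)) + - Z (S x)) \<le> onorm (\<lambda>x. R l (Z (S x))) + onorm (\<lambda>x. Z (S x))"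
      using onorm_triangle[OF bounded_clinear_bounded_linear[OF bounded_clinear_compose[OF G S]]
          bounded_linear_minus[OF bounded_clinear_bounded_linear[OF bounded_clinear_compose[OF Z S]]]]
        onorm_neg[of "\<lambda>x. Z (S x)"] by simp
    moreover have "onorm (\<lambda>x. R l (Z (S x))) \<le> onorm (\<lambda>x. R l (Z x)) * onorm S"
      using onorm_compose[OF bounded_clinear_bounded_linear[OF G] bounded_clinear_bounded_linear[OF S]]
      by (simp add: o_def)
    \<comment> \<open>Only norms enter \<open>onorm\<close>, so scaling by \<open>l\<close> has the
      same effect as scaling by the real number \<open>cmod l\<close>.\<close>
    moreover have "cmod l * onorm (\<lambda>x. R l (Z x)) = onorm (\<lambda>x. l *\<^sub>C R l (Z x))"
      using onorm_scaleR[OF bounded_clinear_bounded_linear[OF G], of "cmod l"]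
      by (simp add: onorm_def norm_scaleC)
    ultimately show "cmod l * onorm (\<lambda>x. R l (Z x)) \<le> onorm (\<lambda>x. Z (S x)) + onorm S * onorm (\<lambda>x. R l (Z x))"
      by (simp add: mult.commute)
  qed
  then show ?thesis using R(2)[of 0 "Z x"] by simp
qed

text \<open>Mirror image of the preceding argument: \<open>S - l\<close> applied after the family
  \<open>Z (1 - l Q)^-1\<close> gives the constant \<open>S Z\<close>.\<close>

lemma quasinilpotent_right_zero:
  assumes Q: "bounded_clinear Q" "op_spectrum Q \<subseteq> {0}"
    and Z: "bounded_clinear Z" and S: "bounded_clinear S" and SZQ: "\<And>x. S (Z (Q x)) = Z x"
  shows "Z x = 0"
proof -
  obtain R where R: "\<And>l. bounded_clinear (R l)" "\<And>l x. R l (x - l *\<^sub>C Q x) = x"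
      "\<And>l x. R l x - l *\<^sub>C Q (R l x) = x"
    using quasinilpotent_resolvent[OF Q(2)] by metis
  have "Z (R 0 x) = 0"
  proof (rule operator_family_vanishes[of "\<lambda>l x. Z (R l x)"])
    show G: "bounded_clinear (\<lambda>x. Z (R l x))" for l by (intro bounded_clinear_intros bounded_clinear_compose[OF R(1)]
        bounded_clinear_compose[OF Z])
    show "(\<lambda>l. cinner (Z (R l x)) y) holomorphic_on UNIV" for x y
      by (rule resolvent_holomorphic[OF Q(1) R(1,2,3)]) (use cinner_functional[OF Z] in auto)
    fix l
    have "l *\<^sub>C Z (R l x) = S (Z (R l x)) - S (Z x)" for x
    proof -
      have "S (Z (R l x - l *\<^sub>C Q (R l x))) = S (Z x)" by (simp add: R(3))
      then show ?thesis by (simp add: SZQ bounded_clinear_simps S Z algebra_simps)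
    qed
    then have "(\<lambda>x. l *\<^sub>C Z (R l x)) = (\<lambda>x. S (Z (R l x)) + - S (Z x))" by auto
    moreover have "onorm (\<lambda>x. S (Z (R l x)) + - S (Z x)) \<le> onorm (\<lambda>x. S (Z (R l x))) + onorm (\<lambda>x. S (Z x))"
      using onorm_triangle[OF bounded_clinear_bounded_linear[OF bounded_clinear_compose[OF S G]]
          bounded_linear_minus[OF bounded_clinear_bounded_linear[OF bounded_clinear_compose[OF S Z]]]]
        onorm_neg[of "\<lambda>x. S (Z x)"] by simp
    moreover have "onorm (\<lambda>x. S (Z (R l x))) \<le> onorm S * onorm (\<lambda>x. Z (R l x))"
      using onorm_compose[OF bounded_clinear_bounded_linear[OF S] bounded_clinear_bounded_linear[OF G]]
      by (simp add: o_def)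
    moreover have "cmod l * onorm (\<lambda>x. Z (R l x)) = onorm (\<lambda>x. l *\<^sub>C Z (R l x))"
      using onorm_scaleR[OF bounded_clinear_bounded_linear[OF G], of "cmod l"]
      by (simp add: onorm_def norm_scaleC)
    ultimately show "cmod l * onorm (\<lambda>x. Z (R l x)) \<le> onorm (\<lambda>x. S (Z x)) + onorm S * onorm (\<lambda>x. Z (R l x))"
      by simp
  qed
  then show ?thesis using R(2)[of 0 x] by simp
qed

text \<open>If \<open>N\<close> were invertible with empty spectrum, then \<open>V = N\<inverse>\<close> would have no nonzero
  spectrum, while \<open>V 1 N = 1\<close>.\<close>

lemma op_spectrum_nonempty:
  fixes N :: "'a::complex_inner \<Rightarrow> 'a"
  assumes N: "bounded_clinear N" and "v \<noteq> (0::'a)"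
  shows "op_spectrum N \<noteq> {}"
proof
  assume empty: "op_spectrum N = {}"
  have inv: "\<exists>U. bounded_clinear U \<and> (\<forall>x. U (c *\<^sub>C x - N x) = x) \<and> (\<forall>x. c *\<^sub>C U x - N (U x) = x)" for c
  proof -
    have "c \<notin> op_spectrum N" using empty by simp
    then show ?thesis unfolding op_spectrum_def invertible_op_def by (auto simp: fun_eq_iff)
  qed
  obtain U where U: "bounded_clinear U" "\<And>x. U (0 *\<^sub>C x - N x) = x" "\<And>x. 0 *\<^sub>C U x - N (U x) = x"
    using inv by blast
  define V where "V = (\<lambda>x. (-1) *\<^sub>C U x)"
  have V: "bounded_clinear V" unfolding V_def by (intro bounded_clinear_intros U(1))
  have VN: "V (N x) = x" and NV: "N (V x) = x" for x
    using U(2)[of "- x"] U(2)[of x] U(3)[of x] bounded_clinear_scaleC[OF U(1), of "-1" "N x"]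
      bounded_clinear_scaleC[OF N, of "-1" "U x"]
    by (simp_all add: V_def scaleC_minus1)
  have "op_spectrum V \<subseteq> {0}"
  proof
    fix c assume c: "c \<in> op_spectrum V"
    have "c = 0"
    proof (rule ccontr)
      assume "c \<noteq> 0"
      obtain T where T: "bounded_clinear T" "\<And>x. T ((1 / c) *\<^sub>C x - N x) = x"
          "\<And>x. (1 / c) *\<^sub>C T x - N (T x) = x"
        using inv by blast
      have TN: "T (N x) = N (T x)" for x
      proof -
        have "T ((1 / c) *\<^sub>C N (T x) - N (N (T x))) = N (T x)" by (rule T(2))
        then have "T (N ((1 / c) *\<^sub>C T x - N (T x))) = N (T x)" by (simp add: N bounded_clinear_simps)
        then show ?thesis by (simp add: T(3))
      qed
      \<comment> \<open>With \<open>V\<close> the inverse of \<open>N\<close>,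
        \<open>c - V = -c (1/c - N) V\<close>; inverting the factors gives \<open>F\<close>.\<close>
      define F where "F = (\<lambda>x. (- (1 / c)) *\<^sub>C N (T x))"
      have F: "bounded_clinear F" unfolding F_def by (intro bounded_clinear_intros
          bounded_clinear_compose[OF N] T(1))
      have neg: "(- (1 / c)) *\<^sub>C y = - ((1 / c) *\<^sub>C y)" for y :: 'a
        using scaleC_scaleC[of "-1" "1 / c" y] by (simp add: scaleC_minus1)
      have "F (c *\<^sub>C x - V x) = x" for x
      proof -
        have "F (c *\<^sub>C x - V x) = - N (T x) + (1 / c) *\<^sub>C N (T (V x))"
          using \<open>c \<noteq> 0\<close>
          by (simp add: F_def N T(1) bounded_clinear_simps scaleC_diff_right neg scaleC_scaleC scaleC_one)
        also have "N (T (V x)) = T x" by (simp add: TN[symmetric] NV)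
        finally show ?thesis using T(3)[of x] by simp
      qed
      moreover have "c *\<^sub>C F x - V (F x) = x" for x
      proof -
        have "c *\<^sub>C F x = - N (T x)"
          using \<open>c \<noteq> 0\<close> by (simp add: F_def scaleC_scaleC scaleC_minus1)
        moreover have "V (F x) = - ((1 / c) *\<^sub>C T x)"
          by (simp only: F_def bounded_clinear_scaleC[OF V] VN) (rule neg)
        ultimately show ?thesis using T(3)[of x] by simp
      qed
      ultimately have "c \<notin> op_spectrum V"
        using F by (auto simp: op_spectrum_def invertible_op_def fun_eq_iff intro!: exI[of _ F])
      then show False using c by simp
    qed
    then show "c \<in> {0}" by simp
  qed
  then have "v = 0"
    using quasinilpotent_left_zero[OF V _ bounded_clinear_ident N, of v] VN by simp
  then show False using \<open>v \<noteq> 0\<close> by simp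
qed

text \<open>Jacobson's lemma: for nonzero \<open>c\<close>,
  \<open>(c - S T)^-1 = (1/c) (1 + S (c - T S)^-1 T)\<close>.\<close>

lemma op_spectrum_commute_subset:
  assumes S: "bounded_clinear S" and T: "bounded_clinear T"
  shows "op_spectrum (\<lambda>x. S (T x)) \<subseteq> insert 0 (op_spectrum (\<lambda>x. T (S x)))"
proof (rule subsetI, rule ccontr)
  fix c assume c: "c \<in> op_spectrum (\<lambda>x. S (T x))" "c \<notin> insert 0 (op_spectrum (\<lambda>x. T (S x)))"
  then have c0: "c \<noteq> 0" by simp
  obtain U where U: "bounded_clinear U" "\<And>x. U (c *\<^sub>C x - T (S x)) = x" "\<And>x. c *\<^sub>C U x - T (S (U x)) = x"
    using c(2) unfolding op_spectrum_def invertible_op_def by (auto simp: fun_eq_iff)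
  define F where "F = (\<lambda>x. (1 / c) *\<^sub>C (x + S (U (T x))))"
  have F: "bounded_clinear F" unfolding F_def by (intro bounded_clinear_intros
      bounded_clinear_compose[OF S] bounded_clinear_compose[OF U(1)] T)
  have "F (c *\<^sub>C x - S (T x)) = x" for x
  proof -
    have "T (c *\<^sub>C x - S (T x)) = c *\<^sub>C T x - T (S (T x))" by (simp add: T bounded_clinear_simps)
    then have "F (c *\<^sub>C x - S (T x)) = (1 / c) *\<^sub>C (c *\<^sub>C x)" by (simp add: F_def U(2))
    then show ?thesis using c0 by (simp add: scaleC_scaleC scaleC_one)
  qed
  moreover have "c *\<^sub>C F x - S (T (F x)) = x" for x
  proof -
    have "S (c *\<^sub>C U (T x) - T (S (U (T x)))) = S (T x)" by (simp add: U(3))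
    then have *: "S (T (S (U (T x)))) = c *\<^sub>C S (U (T x)) - S (T x)"
      by (simp add: S bounded_clinear_simps algebra_simps)
    have "S (T (F x)) = (1 / c) *\<^sub>C (c *\<^sub>C S (U (T x)))"
      by (simp add: F_def S T bounded_clinear_simps * flip: scaleC_add_right)
    then show ?thesis using c0 by (simp add: F_def scaleC_scaleC scaleC_one)
  qed
  ultimately have "c \<notin> op_spectrum (\<lambda>x. S (T x))"
    using F by (auto simp: op_spectrum_def invertible_op_def fun_eq_iff intro!: exI[of _ F])
  then show False using c(1) by simp
qed

text \<open>The definition demands spectrum exactly \<open>{0}\<close>. On the zero space the
  spectrum is empty, so the vector \<open>v\<close> secures that 0 belongs to it.\<close>

lemma quasinilpotent_commute:
  fixes S :: "'b::complex_inner \<Rightarrow> 'a::complex_inner"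
  assumes "bounded_clinear S" "bounded_clinear T" "quasinilpotent (\<lambda>x. T (S x))" "v \<noteq> (0::'a)"
  shows "quasinilpotent (\<lambda>x. S (T x))"
proof -
  have ST: "bounded_clinear (\<lambda>x. S (T x))" by (rule bounded_clinear_compose[OF assms(1,2)])
  have "op_spectrum (\<lambda>x. S (T x)) \<subseteq> {0}"
    using op_spectrum_commute_subset[OF assms(1,2)] assms(3) by (auto simp: quasinilpotent_def)
  then show ?thesis
    using op_spectrum_nonempty[OF ST assms(4)] ST by (auto simp: quasinilpotent_def)
qed

section \<open>Generalized Drazin inverses\<close>

lemma is_gdrazin_inverseD:
  assumes "is_gdrazin_inverse T S"
  shows "bounded_clinear S" "T (S x) = S (T x)" "S (T (S x)) = S x"
    "quasinilpotent (\<lambda>x. T x - T (T (S x)))"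
proof -
  have *: "T \<circ> S = S \<circ> T" "S \<circ> T \<circ> S = S"
    using assms by (simp_all only: is_gdrazin_inverse_def)
  show "T (S x) = S (T x)" "S (T (S x)) = S x"
    using fun_cong[OF *(1), of x] fun_cong[OF *(2), of x] by (simp_all only: o_apply)
qed (use assms in \<open>simp_all add: is_gdrazin_inverse_def\<close>)

text \<open>The second and fourth facts serve as rewrite rules: one moves \<open>A\<close> inwards
  past \<open>W B\<close>, the other absorbs the resulting \<open>B W B W A\<close> into
  \<open>B\<close>.\<close>

lemma is_weighted_gdrazin_inverseD:
  assumes "is_weighted_gdrazin_inverse W A B"
  shows "bounded_clinear B" "A (W (B x)) = B (W (A x))" "B (W (A (W (B x)))) = B x"
    "B (W (B (W (A x)))) = B x" "quasinilpotent (\<lambda>x. A (W x) - A (W (B (W (A (W x))))))"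
proof -
  have *: "A \<circ> W \<circ> B = B \<circ> W \<circ> A" "B \<circ> W \<circ> A \<circ> W \<circ> B = B"
    using assms by (simp_all only: is_weighted_gdrazin_inverse_def)
  show AWB: "A (W (B x)) = B (W (A x))" and BWAWB: "B (W (A (W (B x)))) = B x"
    using fun_cong[OF *(1), of x] fun_cong[OF *(2), of x] by (simp_all only: o_apply)
  show "B (W (B (W (A x)))) = B x" using BWAWB by (simp only: AWB)
  show "bounded_clinear B" using assms by (simp only: is_weighted_gdrazin_inverse_def)
  show "quasinilpotent (\<lambda>x. A (W x) - A (W (B (W (A (W x))))))"
    using assms by (simp add: is_weighted_gdrazin_inverse_def o_def)
qed

text \<open>With \<open>Q = T (1 - T U)\<close>, the operators \<open>Z = (1 - T U) T S\<close> and
  \<open>Z' = T S (1 - T U)\<close> satisfy \<open>Q Z S = Z\<close> and \<open>S Z' Q = Z'\<close>,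
  so both vanish.\<close>

lemma gdrazin_spectral_idempotent:
  assumes T: "bounded_clinear T"
    and S: "is_gdrazin_inverse T S" and U: "is_gdrazin_inverse T U"
  shows "T (U (T (S x))) = T (S x)" and "T (S (T (U x))) = T (S x)"
proof -
  have S': "bounded_clinear S" "\<And>x. S (T x) = T (S x)" "\<And>x. T (S (S x)) = S x"
    using is_gdrazin_inverseD[OF S] by metis+
  have U': "bounded_clinear U" "\<And>x. U (T x) = T (U x)" "\<And>x. T (U (U x)) = U x"
    and qn: "quasinilpotent (\<lambda>x. T x - T (T (U x)))"
    using is_gdrazin_inverseD[OF U] by metis+
  note lin = bounded_clinear_simps[OF T] bounded_clinear_simps[OF S'(1)] bounded_clinear_simps[OF U'(1)]
  let ?Q = "\<lambda>x. T x - T (T (U x))"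
  have Q: "bounded_clinear ?Q" "op_spectrum ?Q \<subseteq> {0}" using qn by (auto simp: quasinilpotent_def)
  let ?Z = "\<lambda>x. T (S x) - T (U (T (S x)))"
  have "?Z x = 0"
  proof (rule quasinilpotent_left_zero[where Z = ?Z and x = x, OF Q _ S'(1)])
    show "bounded_clinear ?Z" by (intro bounded_clinear_intros
        bounded_clinear_compose[OF T] bounded_clinear_compose[OF S'(1)] bounded_clinear_compose[OF U'(1)])
    show "?Q (?Z (S x)) = ?Z x" for x by (simp add: lin S' U')
  qed
  then show "T (U (T (S x))) = T (S x)" by simp
  let ?Z' = "\<lambda>x. T (S x) - T (S (T (U x)))"
  have "?Z' x = 0"
  proof (rule quasinilpotent_right_zero[where Z = ?Z' and x = x, OF Q _ S'(1)])
    show "bounded_clinear ?Z'" by (intro bounded_clinear_intros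
        bounded_clinear_compose[OF T] bounded_clinear_compose[OF S'(1)] bounded_clinear_compose[OF U'(1)])
    show "S (?Z' (?Q x)) = ?Z' x" for x by (simp add: lin S' U')
  qed
  then show "T (S (T (U x))) = T (S x)" by simp
qed

text \<open>Exchanging \<open>S\<close> and \<open>U\<close> in the previous lemma gives
  \<open>T S = T U\<close>, and then \<open>S = S T U = T U U = U\<close>.\<close>

lemma is_gdrazin_inverse_unique:
  assumes T: "bounded_clinear T"
    and S: "is_gdrazin_inverse T S" and U: "is_gdrazin_inverse T U"
  shows "S = U"
proof
  fix x
  note S' = is_gdrazin_inverseD(2,3)[OF S] and U' = is_gdrazin_inverseD(2,3)[OF U]
  have TSTU: "T (S x) = T (U x)" for x
    using gdrazin_spectral_idempotent[OF T S U, of x] gdrazin_spectral_idempotent[OF T U S, of x] by simp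
  have "S x = S (T (U x))" using S'(2)[of x] TSTU[of x] by simp
  also have "\<dots> = T (U (U x))" using S'(1) TSTU by metis
  also have "\<dots> = U x" using U' by simp
  finally show "S x = U x" .
qed

lemma gdrazin_inverse_eq:
  "bounded_clinear T \<Longrightarrow> is_gdrazin_inverse T S \<Longrightarrow> gdrazin_inverse T = S"
  unfolding gdrazin_inverse_def by (rule the_equality) (assumption, rule is_gdrazin_inverse_unique)

section \<open>From weighted to ordinary g-Drazin inverses\<close>

lemma is_weighted_gdrazin_inverse_right:
  assumes W: "bounded_clinear W" and A: "bounded_clinear A"
    and B: "is_weighted_gdrazin_inverse W A B"
  shows "is_gdrazin_inverse (A \<circ> W) (B \<circ> W)"
proof -
  note B' = is_weighted_gdrazin_inverseD[OF B]
  show ?thesis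
    unfolding is_gdrazin_inverse_def
  proof (intro conjI)
    show "quasinilpotent (\<lambda>x. (A \<circ> W) x - (A \<circ> W \<circ> (A \<circ> W) \<circ> (B \<circ> W)) x)"
      using B'(5) unfolding o_apply B'(2) .
  qed (use B' W in \<open>simp_all add: bounded_clinear_comp fun_eq_iff\<close>)
qed

text \<open>The weighted definition states quasinilpotency on the space of \<open>A W\<close>;
  exchanging the factors \<open>A - A W B W A\<close> and \<open>W\<close> carries it over to the
  space of \<open>W A\<close>.\<close>

lemma is_weighted_gdrazin_inverse_left:
  fixes W :: "'y::complex_inner \<Rightarrow> 'x::complex_inner"
  assumes W: "bounded_clinear W" and A: "bounded_clinear A"
    and B: "is_weighted_gdrazin_inverse W A B" and v: "v \<noteq> (0::'x)"
  shows "is_gdrazin_inverse (W \<circ> A) (W \<circ> B)"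
proof -
  note B' = is_weighted_gdrazin_inverseD[OF B]
  have "bounded_clinear (\<lambda>x. A x - A (W (B (W (A x)))))" by (intro bounded_clinear_intros
        bounded_clinear_compose[OF A] bounded_clinear_compose[OF W] bounded_clinear_compose[OF B'(1)])
  from quasinilpotent_commute[OF W this B'(5) v]
  have "quasinilpotent (\<lambda>x. W (A x) - W (A (W (B (W (A x))))))"
    by (simp only: bounded_clinear_diff[OF W])
  then have "quasinilpotent (\<lambda>x. (W \<circ> A) x - (W \<circ> A \<circ> (W \<circ> A) \<circ> (W \<circ> B)) x)"
    unfolding o_apply B'(2) .
  then show ?thesis
    unfolding is_gdrazin_inverse_def using B' W by (simp add: bounded_clinear_comp fun_eq_iff)
qed

text \<open>Both \<open>B W\<close> and \<open>W B\<close> are ordinary g-Drazin inverses, hence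
  determined, and \<open>B = (B W) A (W B)\<close>.\<close>

lemma is_weighted_gdrazin_inverse_unique:
  fixes W :: "'y::complex_inner \<Rightarrow> 'x::complex_inner"
  assumes W: "bounded_clinear W" and A: "bounded_clinear A"
    and B: "is_weighted_gdrazin_inverse W A B" and C: "is_weighted_gdrazin_inverse W A C"
    and v: "v \<noteq> (0::'x)"
  shows "B = C"
proof
  fix x
  have "B \<circ> W = C \<circ> W"
    by (rule is_gdrazin_inverse_unique[of "A \<circ> W"])
      (use assms is_weighted_gdrazin_inverse_right in \<open>auto intro: bounded_clinear_comp\<close>)
  moreover have "W \<circ> B = W \<circ> C"
    by (rule is_gdrazin_inverse_unique[of "W \<circ> A"])
      (use assms is_weighted_gdrazin_inverse_left in \<open>blast intro: bounded_clinear_comp\<close>)+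
  ultimately have eq: "\<And>x. B (W x) = C (W x)" "\<And>x. W (B x) = W (C x)" by (auto simp: fun_eq_iff)
  have "B x = B (W (A (W (B x))))" by (simp only: is_weighted_gdrazin_inverseD(3)[OF B])
  also have "\<dots> = C (W (A (W (C x))))" by (simp add: eq)
  also have "\<dots> = C x" by (rule is_weighted_gdrazin_inverseD(3)[OF C])
  finally show "B x = C x" .
qed

text \<open>\<open>W A W D\<close> is the identity on the range of \<open>W D\<close>, so
  \<open>W A W D P = P\<close>; \<open>D W A W\<close> is the identity on the range of
  \<open>D\<close>, which recovers any candidate from its projector.\<close>

lemma weighted_core_EP_inverse_eq:
  fixes W :: "'y::complex_inner \<Rightarrow> 'x::complex_inner"
  assumes W: "bounded_clinear W" and A: "bounded_clinear A"
    and D: "is_weighted_gdrazin_inverse W A D" and v: "v \<noteq> (0::'x)"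
    and P: "is_orth_projector P (range (W \<circ> D))"
  shows "weighted_core_EP_inverse W A = D \<circ> P"
proof -
  note D' = is_weighted_gdrazin_inverseD(1,2,4)[OF D]
  have wa: "gdrazin_inverse (W \<circ> A) = W \<circ> D"
    using W A D v by (intro gdrazin_inverse_eq is_weighted_gdrazin_inverse_left bounded_clinear_comp)
  have aw: "gdrazin_inverse (A \<circ> W) = D \<circ> W"
    using W A D by (intro gdrazin_inverse_eq is_weighted_gdrazin_inverse_right bounded_clinear_comp)
  have P': "bounded_clinear P" "range P = range (W \<circ> D)"
    using P by (auto simp: is_orth_projector_def is_projector_def)
  have WAWDP: "W (A (W (D (P x)))) = P x" for x
  proof -
    have "P x \<in> range (W \<circ> D)" using P'(2) by blast
    then obtain z where "P x = W (D z)" by auto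
    then show ?thesis by (simp add: D')
  qed
  have "is_weighted_core_EP_inverse W A (D \<circ> P)"
    unfolding is_weighted_core_EP_inverse_def wa aw
  proof (intro conjI)
    show "bounded_clinear (D \<circ> P)" by (intro bounded_clinear_comp D' P')
    have "W \<circ> A \<circ> W \<circ> (D \<circ> P) = P" by (simp add: fun_eq_iff WAWDP)
    then show "is_orth_projector (W \<circ> A \<circ> W \<circ> (D \<circ> P)) (range (W \<circ> D))" using P by simp
    \<comment> \<open>Any value \<open>D y\<close> equals
      \<open>D (W (D (W (A y))))\<close>.\<close>
    have "D (P x) \<in> range (D \<circ> W)" for x
      using D'(3)[of "P x"] by (metis comp_apply rangeI)
    then show "range (D \<circ> P) \<subseteq> range (D \<circ> W)" by auto
  qed
  moreover have "B = D \<circ> P" if "is_weighted_core_EP_inverse W A B" for B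
  proof
    fix x
    have B: "is_orth_projector (W \<circ> A \<circ> W \<circ> B) (range (W \<circ> D))" "range B \<subseteq> range (D \<circ> W)"
      using that by (simp_all add: is_weighted_core_EP_inverse_def wa aw)
    have "W \<circ> A \<circ> W \<circ> B = P"
      using is_projector_unique B(1) P unfolding is_orth_projector_def by blast
    then have "D (W (A (W (B x)))) = D (P x)" by (auto simp: fun_eq_iff)
    moreover obtain z where "B x = D z" using B(2) by force
    ultimately show "B x = (D \<circ> P) x" by (simp add: D')
  qed
  ultimately show ?thesis unfolding weighted_core_EP_inverse_def by (rule the_equality)
qed

section \<open>Existence and uniqueness for the projector system\<close>

theorem theorem2p2:
  fixes W :: "'y::complex_hilbert \<Rightarrow> 'x::complex_hilbert"
    and A :: "'x \<Rightarrow> 'y"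
  assumes "infinite_dimensional TYPE('x)"
    and "infinite_dimensional TYPE('y)"
    and "bounded_clinear W"
    and "W \<noteq> (\<lambda>y. 0)"
    and "bounded_clinear A"
    and "weighted_gdrazin_invertible W A"
  shows "\<forall>B :: 'x \<Rightarrow> 'y.
    (bounded_clinear B \<and>
     is_projector (W \<circ> A \<circ> W \<circ> B)
       (range (W \<circ> weighted_gdrazin_inverse W A))
       (null_space (weighted_core_EP_inverse W A \<circ> W \<circ> A)) \<and>
     range B \<subseteq> range (weighted_gdrazin_inverse W A))
    \<longleftrightarrow> B = ((weighted_core_EP_inverse W A \<circ> W) ^^ 2) \<circ> A"
proof -
  note W = assms(3) and A = assms(5)
  \<comment> \<open>A nonzero value of \<open>W\<close> witnesses that the space \<open>'x\<close>
    is not zero, as the spectral lemmas require.\<close>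
  obtain v :: 'x where v: "v \<noteq> 0" using \<open>W \<noteq> (\<lambda>y. 0)\<close> by (auto simp: fun_eq_iff)
  obtain D where D: "is_weighted_gdrazin_inverse W A D"
    using assms(6) by (auto simp: weighted_gdrazin_invertible_def)
  have wgd: "weighted_gdrazin_inverse W A = D"
    unfolding weighted_gdrazin_inverse_def
    by (rule the_equality, rule D) (rule is_weighted_gdrazin_inverse_unique[OF W A _ D v])
  note D' = is_weighted_gdrazin_inverseD(1,2,4)[OF D]
  note lin = bounded_clinear_simps[OF W] bounded_clinear_simps[OF A] bounded_clinear_simps[OF D'(1)]
  let ?E = "\<lambda>x. W (D (W (A x)))"
  have rangeE: "range ?E = range (W \<circ> D)"
  proof
    show "range ?E \<subseteq> range (W \<circ> D)" by auto
    have "W (D x) = ?E (W (D x))" for x by (simp add: D')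
    then show "range (W \<circ> D) \<subseteq> range ?E" by (metis comp_apply image_subsetI rangeI)
  qed
  obtain P where P: "is_orth_projector P (range (W \<circ> D))"
  proof (rule is_orth_projector_range_idempotent[of ?E])
    show "bounded_clinear ?E" by (intro bounded_clinear_intros
        bounded_clinear_compose[OF W] bounded_clinear_compose[OF D'(1)] A)
    show "?E (?E x) = ?E x" for x by (simp add: D')
  qed (use rangeE in auto)
  have core: "weighted_core_EP_inverse W A = D \<circ> P"
    by (rule weighted_core_EP_inverse_eq[OF W A D v P])
  have P': "bounded_clinear P" "\<And>x. P (P x) = P x" "range P = range (W \<circ> D)"
    using P by (auto simp: is_orth_projector_def is_projector_def fun_eq_iff)
  have PWD: "P (W (D x)) = W (D x)" for x
  proof -
    have "W (D x) \<in> range P" using P'(3) by auto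
    then show ?thesis using P'(2) by auto
  qed
  define B\<^sub>0 where "B\<^sub>0 = (\<lambda>x. D (W (D (P (W (A x))))))"
  have B0: "((D \<circ> P \<circ> W) ^^ 2) \<circ> A = B\<^sub>0"
    by (simp add: fun_eq_iff B\<^sub>0_def numeral_2_eq_2 PWD)
  have B0_lin: "bounded_clinear B\<^sub>0" unfolding B\<^sub>0_def by (intro bounded_clinear_intros
        bounded_clinear_compose[OF W] bounded_clinear_compose[OF D'(1)] bounded_clinear_compose[OF P'(1)] A)
  have WAWB0: "W (A (W (B\<^sub>0 x))) = W (D (P (W (A x))))" for x
    by (simp add: B\<^sub>0_def D')
  have fix_range: "W (A (W (B\<^sub>0 (W (D x))))) = W (D x)" for x
    by (simp add: WAWB0 D' PWD)
  have proj: "is_projector (W \<circ> A \<circ> W \<circ> B\<^sub>0) (range (W \<circ> D)) (null_space (D \<circ> P \<circ> W \<circ> A))"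
    unfolding is_projector_def
  proof (intro conjI)
    show "bounded_clinear (W \<circ> A \<circ> W \<circ> B\<^sub>0)" by (intro bounded_clinear_comp W A B0_lin)
    show "W \<circ> A \<circ> W \<circ> B\<^sub>0 \<circ> (W \<circ> A \<circ> W \<circ> B\<^sub>0) = W \<circ> A \<circ> W \<circ> B\<^sub>0"
      by (simp add: fun_eq_iff WAWB0 D' PWD)
    show "range (W \<circ> A \<circ> W \<circ> B\<^sub>0) = range (W \<circ> D)"
    proof
      show "range (W \<circ> A \<circ> W \<circ> B\<^sub>0) \<subseteq> range (W \<circ> D)" by (auto simp: WAWB0)
      show "range (W \<circ> D) \<subseteq> range (W \<circ> A \<circ> W \<circ> B\<^sub>0)"
        using fix_range by (metis comp_apply image_subsetI rangeI)
    qed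
    \<comment> \<open>Since \<open>D = D W A W D\<close>, \<open>W\<close> is injective on the range
      of \<open>D\<close>; hence the outer \<open>W\<close> in \<open>W D P W A\<close> does not
      change the null space.\<close>
    have "W (D y) = 0 \<longleftrightarrow> D y = 0" for y
      using is_weighted_gdrazin_inverseD(3)[OF D, of y] by (metis lin(3,7,11))
    then show "null_space (W \<circ> A \<circ> W \<circ> B\<^sub>0) = null_space (D \<circ> P \<circ> W \<circ> A)"
      by (simp add: null_space_def WAWB0)
  qed
  have unique: "B = B\<^sub>0"
    if B: "is_projector (W \<circ> A \<circ> W \<circ> B) (range (W \<circ> D)) (null_space (D \<circ> P \<circ> W \<circ> A))"
      "range B \<subseteq> range D" for B
  proof
    fix x
    have "W \<circ> A \<circ> W \<circ> B = W \<circ> A \<circ> W \<circ> B\<^sub>0" by (rule is_projector_unique[OF B(1) proj])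
    \<comment> \<open>Applying \<open>D\<close> on the left recovers \<open>B x\<close> and
      \<open>B\<^sub>0 x\<close>, as both lie in the range of \<open>D\<close>.\<close>
    then have "D (W (A (W (B x)))) = D (W (A (W (B\<^sub>0 x))))" by (auto simp: fun_eq_iff)
    moreover obtain z where "B x = D z" using B(2) by force
    ultimately show "B x = B\<^sub>0 x" by (simp add: B\<^sub>0_def D')
  qed
  have "range B\<^sub>0 \<subseteq> range D" by (auto simp: B\<^sub>0_def)
  then show ?thesis
    unfolding wgd core B0 using unique proj B0_lin by blast
qed

end
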